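(* Let $(\sigma,\alpha)$ be a hypermap on the set $\{1,\ldots,n\}$ and let $t>0$. Then the reliability function of $(\sigma,\alpha)$ is expressed by the Whitney polynomial as $$\mathcal R(\sigma,\alpha;t)=t^{\,n+1-z(\sigma)-z(\alpha)}\prod_{i=1}^n\frac{1}{\widetilde N_i(t)^{z_i(\alpha)}}\;R(\sigma,\alpha;0,t^{-1}).$$
   Context: A collection of hypermaps is a pair $(\sigma,\alpha)$ of permutations of $\{1,\ldots,n\}$; $\kappa(\sigma,\alpha)$ is the number of orbits of $\langle\sigma,\alpha\rangle$. It is a hypermap if $\kappa(\sigma,\alpha)=1$. $z(\pi)$ is the number of cycles of $\pi$ (fixed points included) and $z_i(\pi)$ the number of its cycles of length $i$. A permutation $\beta$ refines $\alpha$, written $\beta\le\alpha$, if for each cycle $\gamma$ of $\alpha$, $\beta$ maps the set of points of $\gamma$ to itself and its restriction $\theta$ to this set of $m$ points satisfies $m+2=z(\theta)+z(\gamma)+z(\gamma^{-1}\theta)$; equivalently the cycles of $\theta$ form a noncrossing partition with respect to the cyclic order $\gamma$, each listing its points in the cyclic order induced by $\gamma$. The Whitney polynomial is $R(\sigma,\alpha;u,v)=\sum_{\beta\le\alpha}u^{\kappa(\sigma,\beta)-\kappa(\sigma,\alpha)}v^{\kappa(\sigma,\beta)+n-z(\beta)-z(\sigma)}$ (with $0^0=1$ upon substitution). The Narayana number $N(m,k)=\frac1m\binom mk\binom m{k-1}$ counts noncrossing partitions of an $m$-element cyclically ordered set into $k$ parts. The reduced Narayana polynomial is $\widetilde N_m(t)=\sum_{k=1}^mN(m,k)t^{k-1}$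 for $m\ge1$. Random model: each cycle of length $m$ of $\alpha$ is independently replaced by a random refinement, a given refinement with $k$ cycles having probability $t^{k-1}/\widetilde N_m(t)$. The reliability function is the probability that the resulting $(\sigma,\beta)$ is still a hypermap, that is, $$\mathcal R(\sigma,\alpha;t)=\prod_{i=1}^n\frac1{\widetilde N_i(t)^{z_i(\alpha)}}\sum_{\beta}t^{z(\beta)-z(\alpha)},$$ the sum being over all refinements $\beta$ of $\alpha$ with $\kappa(\sigma,\beta)=1$. *)

theory Defs
  imports "HOL-Analysis.Analysis" "HOL-Algebra.Sym_Groups" "HOL-Algebra.Group_Action"
    "HOL-Combinatorics.Orbits"
begin

text \<open>
  Permutations of \<open>S\<close> are total functions with \<open>p permutes S\<close>. The constant
  \<open>Orbits.orbit p x\<close> is the orbit of a point under one function, whereas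
  \<open>Group_Action.orbits\<close> is the set of orbits of a group acting on a set.
\<close>

definition cycles_on :: "'a set \<Rightarrow> ('a \<Rightarrow> 'a) \<Rightarrow> 'a set set" where
  "cycles_on S p = Orbits.orbit p ` S"

definition num_cycles :: "'a set \<Rightarrow> ('a \<Rightarrow> 'a) \<Rightarrow> nat" where
  "num_cycles S p = card (cycles_on S p)"

definition num_cycles_of_length :: "nat \<Rightarrow> 'a set \<Rightarrow> ('a \<Rightarrow> 'a) \<Rightarrow> nat" where
  "num_cycles_of_length i S p = card {C \<in> cycles_on S p. card C = i}"

definition kappa :: "nat \<Rightarrow> (nat \<Rightarrow> nat) \<Rightarrow> (nat \<Rightarrow> nat) \<Rightarrow> nat" where
  "kappa n \<sigma> \<alpha> = card (Group_Action.orbits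
     (sym_group n\<lparr>carrier := generate (sym_group n) {\<sigma>, \<alpha>}\<rparr>) {1..n} (\<lambda>g. g))"

definition hypermap_collection :: "nat \<Rightarrow> (nat \<Rightarrow> nat) \<Rightarrow> (nat \<Rightarrow> nat) \<Rightarrow> bool" where
  "hypermap_collection n \<sigma> \<alpha> \<longleftrightarrow> \<sigma> permutes {1..n} \<and> \<alpha> permutes {1..n}"

definition hypermap :: "nat \<Rightarrow> (nat \<Rightarrow> nat) \<Rightarrow> (nat \<Rightarrow> nat) \<Rightarrow> bool" where
  "hypermap n \<sigma> \<alpha> \<longleftrightarrow> hypermap_collection n \<sigma> \<alpha> \<and> kappa n \<sigma> \<alpha> = 1"

definition perm_refines :: "'a set \<Rightarrow> ('a \<Rightarrow> 'a) \<Rightarrow> ('a \<Rightarrow> 'a) \<Rightarrow> bool" where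
  "perm_refines S \<beta> \<alpha> \<longleftrightarrow> \<beta> permutes S \<and>
     (\<forall>C\<in>cycles_on S \<alpha>. \<beta> ` C = C \<and>
        (let \<theta> = perm_restrict \<beta> C; \<gamma> = perm_restrict \<alpha> C
         in card C + 2 = num_cycles C \<theta> + num_cycles C \<gamma>
              + num_cycles C (Hilbert_Choice.inv \<gamma> \<circ> \<theta>)))"

text \<open>
  The exponents are integers, so no subtraction is truncated; \<open>0 powi 0 = 1\<close> is the
  convention for substituting \<open>u = 0\<close> or \<open>v = 0\<close>.
\<close>

definition whitney :: "nat \<Rightarrow> (nat \<Rightarrow> nat) \<Rightarrow> (nat \<Rightarrow> nat) \<Rightarrow> real \<Rightarrow> real \<Rightarrow> real" where
  "whitney n \<sigma> \<alpha> u v = (\<Sum>\<beta> | perm_refines {1..n} \<beta> \<alpha>.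
     u powi (int (kappa n \<sigma> \<beta>) - int (kappa n \<sigma> \<alpha>)) *
     v powi (int (kappa n \<sigma> \<beta>) + int n - int (num_cycles {1..n} \<beta>) - int (num_cycles {1..n} \<sigma>)))"

definition narayana :: "nat \<Rightarrow> nat \<Rightarrow> real" where
  "narayana m k = 1 / real m * real (m choose k) * real (m choose (k - 1))"

definition reduced_narayana :: "nat \<Rightarrow> real \<Rightarrow> real" where
  "reduced_narayana m t = (\<Sum>k=1..m. narayana m k * t ^ (k - 1))"

text \<open>
  A refinement of \<open>\<alpha>\<close> consists of one refinement of each cycle of \<open>\<alpha>\<close>. As these are chosen
  independently, \<open>\<beta>\<close> has as probability the product over the cycles of \<open>\<alpha>\<close>.
\<close>

definition refinement_prob :: "'a set \<Rightarrow> ('a \<Rightarrow> 'a) \<Rightarrow> real \<Rightarrow> ('a \<Rightarrow> 'a) \<Rightarrow> real" where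
  "refinement_prob S \<alpha> t \<beta> = (\<Prod>C\<in>cycles_on S \<alpha>.
     t ^ (num_cycles C (perm_restrict \<beta> C) - 1) / reduced_narayana (card C) t)"

definition random_refinement :: "'a set \<Rightarrow> ('a \<Rightarrow> 'a) \<Rightarrow> real \<Rightarrow> ('a \<Rightarrow> 'a) measure" where
  "random_refinement S \<alpha> t =
     point_measure {\<beta>. perm_refines S \<beta> \<alpha>} (\<lambda>\<beta>. ennreal (refinement_prob S \<alpha> t \<beta>))"

definition reliability :: "nat \<Rightarrow> (nat \<Rightarrow> nat) \<Rightarrow> (nat \<Rightarrow> nat) \<Rightarrow> real \<Rightarrow> real" where
  "reliability n \<sigma> \<alpha> t = measure (random_refinement {1..n} \<alpha> t)
     {\<beta> \<in> space (random_refinement {1..n} \<alpha> t). hypermap n \<sigma> \<beta>}"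

end

theory Submission
  imports Defs
begin

text \<open>
  At \<open>u = 0\<close> the Whitney polynomial keeps exactly the refinements \<open>\<beta>\<close> for which \<open>(\<sigma>, \<beta>)\<close> is a
  hypermap, and these are the refinements counted by the reliability. As the cycles of \<open>\<beta>\<close> refine
  those of \<open>\<alpha>\<close>, the product of the weights \<open>t ^ (k - 1)\<close> over the cycles of \<open>\<alpha>\<close> is
  \<open>t\<close> to the power \<open>z(\<beta>) - z(\<alpha>)\<close>, so both sides agree term by term.
\<close>

lemma finite_cycles_on: "finite S \<Longrightarrow> finite (cycles_on S p)"
  by (simp add: cycles_on_def)

text \<open>A permutation of a finite set is cyclic on each of its orbits, so an orbit is also the
  orbit of any point in it. A common point therefore identifies the two cycles.\<close>

lemma cycles_on_disjoint:
  assumes "finite S" "p permutes S" "C \<in> cycles_on S p" "D \<in> cycles_on S p" "x \<in> C" "x \<in> D"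
  shows "C = D"
proof -
  have "permutation p" using assms permutation_permutes by blast
  moreover obtain a b where "C = Orbits.orbit p a" "D = Orbits.orbit p b"
    using assms by (auto simp: cycles_on_def)
  ultimately show ?thesis
    using assms(5,6) by (metis cyclic_on_orbit' orbit_cyclic_eq3)
qed

lemma Union_cycles_on:
  assumes "finite S" "p permutes S"
  shows "\<Union>(cycles_on S p) = S"
proof -
  have p: "permutation p" using assms permutation_permutes by blast
  show ?thesis
    using permutes_orbit_subset[OF assms(2)] permutation_self_in_orbit[OF p]
    by (fastforce simp: cycles_on_def)
qed

text \<open>The restriction differs from \<open>f\<close> only outside \<open>C\<close>, and an
  orbit that starts in the closed set \<open>C\<close> never gets there.\<close>

lemma orbit_perm_restrict_eq:
  assumes "f ` C \<subseteq> C" "x \<in> C"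
  shows "Orbits.orbit (perm_restrict f C) x = Orbits.orbit f x"
  using assms by (intro orbit_cong0[where A = C]) (auto simp: perm_restrict_def)

lemma cycles_on_perm_restrict:
  assumes "f ` C \<subseteq> C"
  shows "cycles_on C (perm_restrict f C) = cycles_on C f"
  using orbit_perm_restrict_eq[OF assms] by (auto simp: cycles_on_def)

text \<open>Each orbit of \<open>\<beta>\<close> stays inside a single cycle of
  \<open>\<alpha>\<close>, so the cycles of \<open>\<alpha>\<close> sort the cycles of
  \<open>\<beta>\<close> into disjoint classes.\<close>

lemma num_cycles_eq_sum_cycles:
  assumes S: "finite S" and \<alpha>: "\<alpha> permutes S" and \<beta>: "\<beta> permutes S"
    and inv: "\<And>C. C \<in> cycles_on S \<alpha> \<Longrightarrow> \<beta> ` C = C"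
  shows "num_cycles S \<beta> = (\<Sum>C\<in>cycles_on S \<alpha>. num_cycles C (perm_restrict \<beta> C))"
proof -
  have U: "\<Union>(cycles_on S \<alpha>) = S" by (rule Union_cycles_on[OF S \<alpha>])
  \<comment> \<open>Both facts serve disjointness below: a cycle of \<open>\<beta>\<close> listed
    under two cycles of \<open>\<alpha>\<close> would supply a point common to them.\<close>
  have sub: "D \<subseteq> C" "D \<noteq> {}" if C: "C \<in> cycles_on S \<alpha>" and D: "D \<in> cycles_on C \<beta>" for C D
  proof -
    obtain x where x: "x \<in> C" "D = Orbits.orbit \<beta> x" using D by (auto simp: cycles_on_def)
    have "y \<in> C" if "y \<in> Orbits.orbit \<beta> x" for y
      using that x inv[OF C] by induction auto
    then show "D \<subseteq> C" "D \<noteq> {}" using x by (auto simp: orbit_nonempty)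
  qed
  have "cycles_on S \<beta> = (\<Union>C\<in>cycles_on S \<alpha>. cycles_on C \<beta>)"
    unfolding cycles_on_def[of _ \<beta>] using U by blast
  then have "num_cycles S \<beta> = card (\<Union>C\<in>cycles_on S \<alpha>. cycles_on C \<beta>)"
    by (simp add: num_cycles_def)
  also have "\<dots> = (\<Sum>C\<in>cycles_on S \<alpha>. card (cycles_on C \<beta>))"
  proof (rule card_UN_disjoint)
    show "\<forall>C\<in>cycles_on S \<alpha>. finite (cycles_on C \<beta>)"
      using U S by (metis Union_upper finite_cycles_on finite_subset)
    show "\<forall>C\<in>cycles_on S \<alpha>. \<forall>D\<in>cycles_on S \<alpha>. C \<noteq> D \<longrightarrow> cycles_on C \<beta> \<inter> cycles_on D \<beta> = {}"
    proof (intro ballI impI, rule ccontr)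
      fix C D assume CD: "C \<in> cycles_on S \<alpha>" "D \<in> cycles_on S \<alpha>" "C \<noteq> D"
        and "cycles_on C \<beta> \<inter> cycles_on D \<beta> \<noteq> {}"
      then obtain E where "E \<in> cycles_on C \<beta>" "E \<in> cycles_on D \<beta>" by blast
      with CD sub obtain x where "x \<in> C" "x \<in> D" by blast
      with CD cycles_on_disjoint[OF S \<alpha>] show False by blast
    qed
  qed (simp add: S finite_cycles_on)
  also have "\<dots> = (\<Sum>C\<in>cycles_on S \<alpha>. num_cycles C (perm_restrict \<beta> C))"
    by (rule sum.cong) (simp_all add: num_cycles_def cycles_on_perm_restrict inv)
  finally show ?thesis .
qed

text \<open>Grouping the cycles by length turns the product over cycles in
  \<open>refinement_prob\<close> into the product with exponents \<open>z_i\<close> of the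
  theorem.\<close>

lemma prod_cycles_by_length:
  fixes g :: "nat \<Rightarrow> 'a::comm_monoid_mult"
  assumes "p permutes {1..n}"
  shows "(\<Prod>C\<in>cycles_on {1..n} p. g (card C)) =
    (\<Prod>i=1..n. g i ^ num_cycles_of_length i {1..n} p)"
proof -
  let ?K = "cycles_on {1..n} p"
  \<comment> \<open>Every cycle length is one of the indices, so the grouping loses no
    factor.\<close>
  have "card C \<in> {1..n}" if C: "C \<in> ?K" for C
  proof -
    have "C \<subseteq> {1..n}" using Union_cycles_on[OF _ assms] C by blast
    moreover have "C \<noteq> {}" using C by (auto simp: cycles_on_def orbit_nonempty)
    ultimately show ?thesis
      using card_mono[of "{1..n}" C] finite_subset[of C "{1..n}"]
      by (simp add: Suc_le_eq card_gt_0_iff)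
  qed
  then have "(\<Prod>C\<in>?K. g (card C)) = (\<Prod>i=1..n. \<Prod>C | C \<in> ?K \<and> card C = i. g (card C))"
    by (intro prod.group[symmetric]) (auto simp: finite_cycles_on)
  also have "\<dots> = (\<Prod>i=1..n. g i ^ num_cycles_of_length i {1..n} p)"
    by (rule prod.cong) (simp_all add: num_cycles_of_length_def)
  finally show ?thesis .
qed

text \<open>Nonnegative weights are needed because \<open>ennreal\<close> sends negative reals to
  0.\<close>

lemma reduced_narayana_nonneg: "t \<ge> 0 \<Longrightarrow> reduced_narayana m t \<ge> 0"
  unfolding reduced_narayana_def narayana_def by (intro sum_nonneg) simp

lemma refinement_prob_nonneg: "t \<ge> 0 \<Longrightarrow> refinement_prob S \<alpha> t \<beta> \<ge> 0"
  unfolding refinement_prob_def by (intro prod_nonneg) (simp add: reduced_narayana_nonneg)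

lemma finite_refinements: "finite S \<Longrightarrow> finite {\<beta>. perm_refines S \<beta> \<alpha>}"
  by (rule finite_subset[OF _ finite_permutations[of S]]) (auto simp: perm_refines_def)

text \<open>Each cycle of \<open>\<alpha>\<close> contributes its number of
  \<open>\<beta>\<close>-cycles minus 1 to the exponent of \<open>t\<close>; these contributions add
  up to \<open>z(\<beta>) - z(\<alpha>)\<close>.\<close>

lemma refinement_prob_eq:
  assumes \<alpha>: "\<alpha> permutes {1..n}" and ref: "perm_refines {1..n} \<beta> \<alpha>"
  shows "refinement_prob {1..n} \<alpha> t \<beta> =
    t powi (int (num_cycles {1..n} \<beta>) - int (num_cycles {1..n} \<alpha>)) *
    (\<Prod>i=1..n. 1 / reduced_narayana i t ^ num_cycles_of_length i {1..n} \<alpha>)"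
proof -
  let ?K = "cycles_on {1..n} \<alpha>" and ?z = "\<lambda>C. num_cycles C (perm_restrict \<beta> C)"
  have z: "num_cycles {1..n} \<beta> = (\<Sum>C\<in>?K. ?z C)"
    using \<alpha> ref by (intro num_cycles_eq_sum_cycles) (auto simp: perm_refines_def)
  \<comment> \<open>Guarantees that the natural-number subtraction \<open>?z C - 1\<close> is not
    truncated.\<close>
  have pos: "1 \<le> ?z C" if C: "C \<in> ?K" for C
  proof -
    have "C \<noteq> {}" using C by (auto simp: cycles_on_def orbit_nonempty)
    moreover have "finite C"
      using Union_cycles_on[OF _ \<alpha>] C by (metis Union_upper finite_atLeastAtMost finite_subset)
    ultimately show ?thesis
      by (simp add: num_cycles_def cycles_on_def Suc_le_eq card_gt_0_iff)
  qed
  have "int (\<Sum>C\<in>?K. ?z C - 1) = (\<Sum>C\<in>?K. int (?z C) - 1)"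
    using pos by (simp add: of_nat_diff)
  also have "\<dots> = int (num_cycles {1..n} \<beta>) - int (num_cycles {1..n} \<alpha>)"
    unfolding z by (simp add: sum_subtractf num_cycles_def[of _ \<alpha>])
  finally have e: "int (num_cycles {1..n} \<beta>) - int (num_cycles {1..n} \<alpha>) = int (\<Sum>C\<in>?K. ?z C - 1)"
    by simp
  have "refinement_prob {1..n} \<alpha> t \<beta> =
      (\<Prod>C\<in>?K. t ^ (?z C - 1)) * (1 / (\<Prod>C\<in>?K. reduced_narayana (card C) t))"
    by (simp add: refinement_prob_def prod_dividef)
  also have "(\<Prod>C\<in>?K. t ^ (?z C - 1)) =
      t powi (int (num_cycles {1..n} \<beta>) - int (num_cycles {1..n} \<alpha>))"
    unfolding e power_int_of_nat by (simp add: power_sum)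
  finally show ?thesis
    unfolding prod_cycles_by_length[OF \<alpha>, of "\<lambda>m. reduced_narayana m t"] by (simp add: prod_dividef)
qed

lemma reliability_eq_sum:
  assumes "t \<ge> 0"
  shows "reliability n \<sigma> \<alpha> t =
    (\<Sum>\<beta> | perm_refines {1..n} \<beta> \<alpha> \<and> hypermap n \<sigma> \<beta>. refinement_prob {1..n} \<alpha> t \<beta>)"
  using assms
  by (simp add: reliability_def random_refinement_def space_point_measure subset_eq
      measure_point_measure_finite_if finite_refinements refinement_prob_nonneg)

theorem mainTheorem4:
  fixes n :: nat and \<sigma> \<alpha> :: "nat \<Rightarrow> nat" and t :: real
  assumes "hypermap n \<sigma> \<alpha>"
    and "t > 0"
  shows "reliability n \<sigma> \<alpha> t =
    t powi (int n + 1 - int (num_cycles {1..n} \<sigma>) - int (num_cycles {1..n} \<alpha>)) *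
    (\<Prod>i=1..n. 1 / reduced_narayana i t ^ num_cycles_of_length i {1..n} \<alpha>) *
    whitney n \<sigma> \<alpha> 0 (inverse t)"
proof -
  let ?R = "{\<beta>. perm_refines {1..n} \<beta> \<alpha>}"
  let ?z = "\<lambda>p. int (num_cycles {1..n} p)"
  let ?P = "\<Prod>i=1..n. 1 / reduced_narayana i t ^ num_cycles_of_length i {1..n} \<alpha>"
  have \<sigma>: "\<sigma> permutes {1..n}" and \<alpha>: "\<alpha> permutes {1..n}" and \<kappa>: "kappa n \<sigma> \<alpha> = 1"
    using assms(1) by (auto simp: hypermap_def hypermap_collection_def)
  have hyp: "hypermap n \<sigma> \<beta> \<longleftrightarrow> kappa n \<sigma> \<beta> = 1" if "\<beta> \<in> ?R" for \<beta>
    using that \<sigma> by (simp add: hypermap_def hypermap_collection_def perm_refines_def)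
  \<comment> \<open>Writing the event as a conditional keeps the sum over all refinements, the index
    set of \<open>whitney\<close>, so that the two sums can be compared term by term.\<close>
  have "reliability n \<sigma> \<alpha> t =
      (\<Sum>\<beta>\<in>?R. if hypermap n \<sigma> \<beta> then refinement_prob {1..n} \<alpha> t \<beta> else 0)"
    using assms(2) by (simp add: reliability_eq_sum sum.If_cases finite_refinements Collect_conj_eq)
  also have "\<dots> = (\<Sum>\<beta>\<in>?R. t powi (int n + 1 - ?z \<sigma> - ?z \<alpha>) * ?P *
      (0 powi (int (kappa n \<sigma> \<beta>) - int (kappa n \<sigma> \<alpha>)) *
       inverse t powi (int (kappa n \<sigma> \<beta>) + int n - ?z \<beta> - ?z \<sigma>)))"
  proof (rule sum.cong)
    fix \<beta> assume \<beta>: "\<beta> \<in> ?R"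
    show "(if hypermap n \<sigma> \<beta> then refinement_prob {1..n} \<alpha> t \<beta> else 0) =
      t powi (int n + 1 - ?z \<sigma> - ?z \<alpha>) * ?P *
      (0 powi (int (kappa n \<sigma> \<beta>) - int (kappa n \<sigma> \<alpha>)) *
       inverse t powi (int (kappa n \<sigma> \<beta>) + int n - ?z \<beta> - ?z \<sigma>))"
    proof (cases "kappa n \<sigma> \<beta> = 1")
      case True
      \<comment> \<open>The inverse base negates the second exponent; as \<open>t\<close> is
        nonzero, the exponents combine, and \<open>n\<close>, 1 and \<open>z(\<sigma>)\<close>
        cancel.\<close>
      have "t powi (int n + 1 - ?z \<sigma> - ?z \<alpha>) * inverse t powi (1 + int n - ?z \<beta> - ?z \<sigma>)
          = t powi ((int n + 1 - ?z \<sigma> - ?z \<alpha>) - (1 + int n - ?z \<beta> - ?z \<sigma>))"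
        using assms(2)
        by (simp only: power_int_diff power_int_inverse divide_inverse
            less_imp_neq[symmetric] simp_thms)
      also have "\<dots> = t powi (?z \<beta> - ?z \<alpha>)" by simp
      finally have "t powi (int n + 1 - ?z \<sigma> - ?z \<alpha>) * inverse t powi (1 + int n - ?z \<beta> - ?z \<sigma>)
          = t powi (?z \<beta> - ?z \<alpha>)" .
      moreover have "refinement_prob {1..n} \<alpha> t \<beta> = t powi (?z \<beta> - ?z \<alpha>) * ?P"
        using refinement_prob_eq[OF \<alpha>] \<beta> by blast
      \<comment> \<open>Here both values of \<open>kappa\<close> are 1, and the factor in
        \<open>u\<close> is \<open>0 powi 0 = 1\<close>.\<close>
      ultimately show ?thesis
        using True hyp[OF \<beta>] \<kappa> by (simp add: mult_ac)
    next
      case False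
      \<comment> \<open>The exponent of 0 is now nonzero; whatever its sign, the power is 0, since
        \<open>inverse 0 = 0\<close>.\<close>
      then show ?thesis using hyp[OF \<beta>] \<kappa> by (simp add: power_int_0_left_if)
    qed
  qed simp
  also have "\<dots> = t powi (int n + 1 - ?z \<sigma> - ?z \<alpha>) * ?P * whitney n \<sigma> \<alpha> 0 (inverse t)"
    by (simp add: whitney_def sum_distrib_left)
  finally show ?thesis .
qed

end
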